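(* Let $k\in\mathbb{N}$ and let $G$ be a finitely generated group. Then $\mathrm{dc}_M^k(G)$ takes the same value for all sequences $M$ of probability measures that measure index uniformly on $G$, and for every such sequence $M=(\mu_n)_{n=1}^\infty$ the $\limsup$ in the definition $\mathrm{dc}_M^k(G)=\limsup_{n\to\infty}\mathrm{dc}^k_{\mu_n}(G)$ is actually a limit.
   Context: Groups are discrete. Simple commutators are defined by $[x_1,x_2]=x_1^{-1}x_2^{-1}x_1x_2$ and $[x_1,\ldots,x_k]=[[x_1,\ldots,x_{k-1}],x_k]$. For a probability measure $\mu$ on $G$, $\mathrm{dc}^k_\mu(G)$ is the probability that $[x_1,\ldots,x_{k+1}]=1$ when $x_1,\ldots,x_{k+1}$ are chosen independently according to $\mu$. A sequence $M=(\mu_n)_{n=1}^\infty$ of probability measures on $G$ measures index uniformly if $\mu_n(xH)\to1/[G:H]$ as $n\to\infty$, uniformly over all $x\in G$ and all subgroups $H$ of $G$, where $1/[G:H]=0$ if $[G:H]=\infty$. *)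

theory Defs
  imports "HOL-Probability.Probability" "HOL-Algebra.Left_Coset" "HOL-Algebra.Generated_Groups"
begin

definition commutator :: "('a, 'b) monoid_scheme \<Rightarrow> 'a \<Rightarrow> 'a \<Rightarrow> 'a" where
  "commutator G x y = inv\<^bsub>G\<^esub> x \<otimes>\<^bsub>G\<^esub> inv\<^bsub>G\<^esub> y \<otimes>\<^bsub>G\<^esub> x \<otimes>\<^bsub>G\<^esub> y"

(* Entries are indexed from 0: simple_commutator G x k is the simple commutator
   [x 0, ..., x k], which has k + 1 entries.  A single entry is its own commutator. *)
primrec simple_commutator :: "('a, 'b) monoid_scheme \<Rightarrow> (nat \<Rightarrow> 'a) \<Rightarrow> nat \<Rightarrow> 'a" where
  "simple_commutator G x 0 = x 0"
| "simple_commutator G x (Suc k) = commutator G (simple_commutator G x k) (x (Suc k))"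

definition finitely_generated_group :: "('a, 'b) monoid_scheme \<Rightarrow> bool" where
  "finitely_generated_group G \<longleftrightarrow>
     group G \<and> (\<exists>S. finite S \<and> S \<subseteq> carrier G \<and> generate G S = carrier G)"

(* G is discrete, so every subset of the carrier is measurable. *)
definition prob_measure_on :: "('a, 'b) monoid_scheme \<Rightarrow> 'a measure \<Rightarrow> bool" where
  "prob_measure_on G \<mu> \<longleftrightarrow> prob_space \<mu> \<and> space \<mu> = carrier G \<and> sets \<mu> = Pow (carrier G)"

(* Independent choices are modelled by the product measure.  If G is countable (in
   particular if it is finitely generated), every set of (k + 1)-tuples over the carrier
   is measurable for it, so this is the genuine probability of the event. *)
definition dc :: "nat \<Rightarrow> ('a, 'b) monoid_scheme \<Rightarrow> 'a measure \<Rightarrow> real" where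
  "dc k G \<mu> = (let P = Pi\<^sub>M {..k} (\<lambda>_. \<mu>) in
     measure P {x \<in> space P. simple_commutator G x k = \<one>\<^bsub>G\<^esub>})"

(* 1 / [G : H], with value 0 if the index is infinite. *)
definition inverse_index :: "('a, 'b) monoid_scheme \<Rightarrow> 'a set \<Rightarrow> real" where
  "inverse_index G H = (if finite (lcosets\<^bsub>G\<^esub> H) then 1 / real (card (lcosets\<^bsub>G\<^esub> H)) else 0)"

definition measures_index_uniformly ::
    "('a, 'b) monoid_scheme \<Rightarrow> (nat \<Rightarrow> 'a measure) \<Rightarrow> bool" where
  "measures_index_uniformly G M \<longleftrightarrow>
     (\<forall>n. prob_measure_on G (M n)) \<and>
     uniform_limit (carrier G \<times> {H. subgroup H G})
       (\<lambda>n (x, H). measure (M n) (x <#\<^bsub>G\<^esub> H)) (\<lambda>(x, H). inverse_index G H) sequentially"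

definition dc_limsup :: "nat \<Rightarrow> ('a, 'b) monoid_scheme \<Rightarrow> (nat \<Rightarrow> 'a measure) \<Rightarrow> ereal" where
  "dc_limsup k G M = limsup (\<lambda>n. ereal (dc k G (M n)))"

end

theory Submission
  imports Defs
begin

text \<open>
  Call a subgroup almost normal if its normalizer has finite index. By induction on \<open>k\<close>, the
  probability that \<open>[x\<^sub>0, \<dots>, x\<^sub>k] \<in> yA\<close> converges for every almost normal \<open>A\<close> and every \<open>y\<close>, as the
  measure becomes index-uniform. For the induction step let \<open>w = [x\<^sub>0, \<dots>, x\<^sub>k]\<close> and let \<open>N\<close> be normal of
  finite index and normalize \<open>A\<close>. On each coset of \<open>N\<close>, the set of \<open>x\<close> with \<open>[w, x] \<in> yA\<close> is empty or a
  coset of a subgroup \<open>T\<close> that depends on \<open>w\<close>. Those \<open>T\<close> of index more than \<open>r\<close> contribute little.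
  A finitely generated group has only finitely many subgroups of index at most \<open>r\<close>, so all
  other \<open>T\<close> contain one normal subgroup \<open>K\<close> of finite index. For them the condition depends only on the
  coset of \<open>x\<close> modulo \<open>K\<close>, and for a fixed such coset it says that \<open>w\<close> lies in a finite union of cosets
  of a subgroup normalized by \<open>K\<close>, to which the induction hypothesis applies.
\<close>

(* The multiset notation makes every coset x <# H ambiguous. *)
no_notation Multiset.subset_mset (infix \<open><#\<close> 50)

section \<open>Commutators and almost normal subgroups\<close>

definition conjugate :: "('a, 'b) monoid_scheme \<Rightarrow> 'a \<Rightarrow> 'a \<Rightarrow> 'a" where
  "conjugate G w x = inv\<^bsub>G\<^esub> x \<otimes>\<^bsub>G\<^esub> w \<otimes>\<^bsub>G\<^esub> x"

context group
begin

section \<open>Word identities for commutators and conjugates\<close>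

lemma inv_mult_cancel_left:
  assumes "x \<in> carrier G" "y \<in> carrier G"
  shows "inv x \<otimes> (x \<otimes> y) = y" "x \<otimes> (inv x \<otimes> y) = y"
  using assms by (simp_all flip: m_assoc)

text \<open>Unfolds everything to words, associates to the right and cancels adjacent inverse pairs,
  so that the identities below become free reduction.\<close>

lemmas group_word_simps = commutator_def conjugate_def m_assoc inv_mult_group inv_mult_cancel_left

lemma commutator_closed [simp]:
  "x \<in> carrier G \<Longrightarrow> y \<in> carrier G \<Longrightarrow> commutator G x y \<in> carrier G"
  by (simp add: commutator_def)

lemma conjugate_closed [simp]:
  "x \<in> carrier G \<Longrightarrow> y \<in> carrier G \<Longrightarrow> conjugate G x y \<in> carrier G"
  by (simp add: conjugate_def)

lemma conjugate_mult:
  assumes "v \<in> carrier G" "w \<in> carrier G" "x \<in> carrier G"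
  shows "conjugate G (v \<otimes> w) x = conjugate G v x \<otimes> conjugate G w x"
  using assms by (simp add: group_word_simps)

lemma conjugate_inv:
  assumes "w \<in> carrier G" "x \<in> carrier G"
  shows "conjugate G (inv w) x = inv (conjugate G w x)"
  using assms by (simp add: group_word_simps)

lemma conjugate_one: "x \<in> carrier G \<Longrightarrow> conjugate G \<one> x = \<one>"
  by (simp add: group_word_simps)

lemma commutator_one: "x \<in> carrier G \<Longrightarrow> commutator G \<one> x = \<one>" "x \<in> carrier G \<Longrightarrow> commutator G x \<one> = \<one>"
  by (simp_all add: group_word_simps)

lemma commutator_mult_left:
  assumes "v \<in> carrier G" "w \<in> carrier G" "x \<in> carrier G"
  shows "commutator G (v \<otimes> w) x = conjugate G (commutator G v x) w \<otimes> commutator G w x"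
  using assms by (simp add: group_word_simps)

text \<open>As \<open>[w, x]\<close> is \<open>inv w\<close> times \<open>w^x\<close>, the first
  form telescopes. It shows that \<open>[w, xk]\<close> is in \<open>yA\<close> for every
  \<open>k\<close> of a subgroup \<open>K\<close> iff \<open>[w, x]\<close> is in \<open>yA\<close>
  and every \<open>[w^x, k]\<close> is in \<open>A\<close>, which is how
  \<open>commuting_part\<close> is encoded.\<close>

lemma commutator_mult_right:
  assumes "w \<in> carrier G" "x \<in> carrier G" "y \<in> carrier G"
  shows "commutator G w (x \<otimes> y) = commutator G w x \<otimes> commutator G (conjugate G w x) y"
    and "commutator G w (x \<otimes> y) = commutator G w y \<otimes> conjugate G (commutator G w x) y"
  using assms by (simp_all add: group_word_simps)

lemma commutator_inv_left:
  assumes "w \<in> carrier G" "x \<in> carrier G"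
  shows "commutator G (inv w) x = inv (conjugate G (commutator G w x) (inv w))"
  using assms by (simp add: group_word_simps)

lemma commutator_inv_right:
  assumes "w \<in> carrier G" "x \<in> carrier G"
  shows "commutator G w (inv x) = inv (conjugate G (commutator G w x) (inv x))"
  using assms by (simp add: group_word_simps)

section \<open>Coset structure of the condition that a commutator lies in a given coset\<close>

lemma mem_l_coset_iff:
  assumes "subgroup H G" "x \<in> carrier G" "y \<in> carrier G"
  shows "y \<in> x <# H \<longleftrightarrow> inv x \<otimes> y \<in> H"
proof
  assume "y \<in> x <# H"
  then obtain h where h: "h \<in> H" "y = x \<otimes> h" by (auto simp: l_coset_def)
  then show "inv x \<otimes> y \<in> H"
    using assms by (simp add: inv_mult_cancel_left subgroup.mem_carrier)
next
  assume h: "inv x \<otimes> y \<in> H"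
  have "y = x \<otimes> (inv x \<otimes> y)" using assms by (simp add: inv_mult_cancel_left)
  then show "y \<in> x <# H" using h unfolding l_coset_def by blast
qed

lemma conjugate_mem_normal:
  assumes "N \<lhd> G" "n \<in> N" "x \<in> carrier G"
  shows "conjugate G n x \<in> N"
  using normal.inv_op_closed1[OF assms(1)] assms by (simp add: conjugate_def)

text \<open>\<open>N\<close> is carried as a witness that the normalizer of \<open>A\<close> has
  finite index. It changes along the induction: \<open>A\<close> and \<open>N\<close> give way to a
  stabilizer and a normal subgroup \<open>K\<close> inside \<open>N\<close>.\<close>

definition almost_normal :: "'a set \<Rightarrow> 'a set \<Rightarrow> bool" where
  "almost_normal A N \<longleftrightarrow> N \<lhd> G \<and> finite (lcosets N) \<and> subgroup A G \<and> A \<subseteq> N \<and>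
     (\<forall>n\<in>N. \<forall>a\<in>A. conjugate G a n \<in> A)"

text \<open>The set of those \<open>w\<close> for which \<open>[w, xk] \<in> yA\<close> for all \<open>k \<in> K\<close>.\<close>

definition commuting_part :: "'a set \<Rightarrow> 'a set \<Rightarrow> 'a \<Rightarrow> 'a \<Rightarrow> 'a set" where
  "commuting_part A K y x = {w \<in> carrier G. commutator G w x \<in> y <# A \<and>
     (\<forall>k\<in>K. commutator G (conjugate G w x) k \<in> A)}"

text \<open>The intersection of \<open>commuting_part A K y x\<close> with a coset of \<open>K\<close> is empty or a left coset of this subgroup.\<close>

definition commuting_stabilizer :: "'a set \<Rightarrow> 'a set \<Rightarrow> 'a \<Rightarrow> 'a \<Rightarrow> 'a set" where
  "commuting_stabilizer A K y x = {v \<in> K. inv (conjugate G v y) \<otimes> conjugate G v x \<in> A \<and>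
     (\<forall>k\<in>K. commutator G (conjugate G v x) k \<in> A)}"

lemma mult_mem_subgroup_iff:
  assumes "subgroup A G" "a \<in> A" "z \<in> carrier G"
  shows "a \<otimes> z \<in> A \<longleftrightarrow> z \<in> A" "z \<otimes> a \<in> A \<longleftrightarrow> z \<in> A"
proof -
  have c: "a \<in> carrier G" using assms by (simp add: subgroup.mem_carrier)
  have "inv a \<in> A" using assms by (simp add: subgroup.m_inv_closed)
  have "z = inv a \<otimes> (a \<otimes> z)" "z = (z \<otimes> a) \<otimes> inv a"
    using assms c by (simp_all add: inv_mult_cancel_left m_assoc)
  with \<open>inv a \<in> A\<close> assms(1,2) show "a \<otimes> z \<in> A \<longleftrightarrow> z \<in> A" "z \<otimes> a \<in> A \<longleftrightarrow> z \<in> A"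
    by (metis subgroup.m_closed)+
qed

text \<open>With \<open>p = v^x\<close> and \<open>q = v^y\<close>, both in \<open>K\<close>,
  membership says that \<open>inv q \<otimes> p\<close> and all \<open>[p, k]\<close> lie in
  \<open>A\<close>. Commutator identities reduce the subgroup laws to the invariance of
  \<open>A\<close> under conjugation by \<open>K\<close>. The condition on \<open>[p, k]\<close> is
  what makes the stabilizer itself invariant under \<open>K\<close>.\<close>

lemma almost_normal_commuting_stabilizer:
  assumes AN: "almost_normal A N" and K: "K \<lhd> G" "finite (lcosets K)" "K \<subseteq> N"
    and y: "y \<in> carrier G" and x: "x \<in> carrier G"
  shows "almost_normal (commuting_stabilizer A K y x) K"
proof -
  let ?C = "commuting_stabilizer A K y x"
  have A: "subgroup A G" and N: "N \<lhd> G" and conjA: "\<And>n a. n \<in> N \<Longrightarrow> a \<in> A \<Longrightarrow> conjugate G a n \<in> A"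
    using AN by (auto simp: almost_normal_def)
  have Ksub: "subgroup K G" using K(1) by (simp add: normal_imp_subgroup)
  have Kc [simp]: "k \<in> carrier G" if "k \<in> K" for k using that Ksub by (rule subgroup.mem_carrier[rotated])
  have Ac [simp]: "a \<in> carrier G" if "a \<in> A" for a using that A by (rule subgroup.mem_carrier[rotated])
  note conjK = conjugate_mem_normal[OF K(1)]
  note Aops = subgroup.m_closed[OF A] subgroup.m_inv_closed[OF A]
  have KN: "\<And>k. k \<in> K \<Longrightarrow> k \<in> N" using K by blast
  have sub: "subgroup ?C G"
  proof (rule subgroupI)
    show "?C \<subseteq> carrier G" by (auto simp: commuting_stabilizer_def)
    have "\<one> \<in> ?C" using x y subgroup.one_closed[OF A] subgroup.one_closed[OF Ksub]
      by (simp add: commuting_stabilizer_def conjugate_one commutator_one)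
    then show "?C \<noteq> {}" by blast
  next
    fix v assume v: "v \<in> ?C"
    then have vK: "v \<in> K" by (simp add: commuting_stabilizer_def)
    let ?p = "conjugate G v x" and ?q = "conjugate G v y"
    have pK: "?p \<in> K" "?q \<in> K" using vK x y conjK by auto
    have "inv ?q \<otimes> ?p \<in> A" using v by (simp add: commuting_stabilizer_def)
    then have "conjugate G (inv (inv ?q \<otimes> ?p)) (inv ?q) \<in> A"
      using pK KN Aops by (intro conjA) (auto simp: subgroup.m_inv_closed[OF Ksub])
    moreover have "conjugate G (inv (inv ?q \<otimes> ?p)) (inv ?q) = inv (conjugate G (inv v) y) \<otimes> conjugate G (inv v) x"
      using vK x y by (simp add: group_word_simps)
    moreover have "commutator G (conjugate G (inv v) x) k \<in> A" if k: "k \<in> K" for k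
    proof -
      have "commutator G ?p k \<in> A" using v k by (simp add: commuting_stabilizer_def)
      then show ?thesis using vK x k pK conjA KN Aops
        by (simp add: conjugate_inv commutator_inv_left subgroup.m_inv_closed[OF Ksub])
    qed
    ultimately show "inv v \<in> ?C" using vK subgroup.m_inv_closed[OF Ksub] by (simp add: commuting_stabilizer_def)
  next
    fix v v' assume v: "v \<in> ?C" "v' \<in> ?C"
    then have vK: "v \<in> K" "v' \<in> K" by (simp_all add: commuting_stabilizer_def)
    let ?p = "conjugate G v x" and ?q = "conjugate G v y"
    let ?p' = "conjugate G v' x" and ?q' = "conjugate G v' y"
    have pK: "?p \<in> K" "?q \<in> K" "?p' \<in> K" "?q' \<in> K" using vK x y conjK by auto
    have "conjugate G (inv ?q \<otimes> ?p) ?p' \<in> A" "inv ?q' \<otimes> ?p' \<in> A"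
      using v pK KN by (auto simp: commuting_stabilizer_def intro!: conjA)
    then have "(inv ?q' \<otimes> ?p') \<otimes> conjugate G (inv ?q \<otimes> ?p) ?p' \<in> A" using Aops by blast
    moreover have "(inv ?q' \<otimes> ?p') \<otimes> conjugate G (inv ?q \<otimes> ?p) ?p'
        = inv (conjugate G (v \<otimes> v') y) \<otimes> conjugate G (v \<otimes> v') x"
      using vK x y by (simp add: group_word_simps)
    moreover have "commutator G (conjugate G (v \<otimes> v') x) k \<in> A" if k: "k \<in> K" for k
    proof -
      have "commutator G ?p k \<in> A" "commutator G ?p' k \<in> A" using v k by (simp_all add: commuting_stabilizer_def)
      then show ?thesis using vK x k pK conjA KN Aops
        by (simp add: conjugate_mult commutator_mult_left)
    qed
    ultimately show "v \<otimes> v' \<in> ?C"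
      using vK subgroup.m_closed[OF Ksub] by (simp add: commuting_stabilizer_def)
  qed
  have "conjugate G v n \<in> ?C" if n: "n \<in> K" and v: "v \<in> ?C" for n v
  proof -
    have vK: "v \<in> K" using v by (simp add: commuting_stabilizer_def)
    let ?p = "conjugate G v x" and ?q = "conjugate G v y"
    let ?m = "conjugate G n x" and ?l = "conjugate G n y"
    have mK: "?m \<in> K" "?l \<in> K" "?p \<in> K" "?q \<in> K" using n vK x y conjK by auto
    have "commutator G ?p ?m \<in> A" "commutator G ?p ?l \<in> A" "inv ?q \<otimes> ?p \<in> A"
      using v mK by (auto simp: commuting_stabilizer_def)
    moreover from this have "conjugate G (inv ?q \<otimes> ?p) ?l \<in> A" using mK KN conjA by blast
    \<comment> \<open>Replacing \<open>v\<close> by \<open>v^n\<close> turns \<open>p\<close> and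
      \<open>q\<close> into \<open>p^m\<close> and \<open>q^l\<close>, with different conjugators.
      The factors \<open>[p, l]\<close> and \<open>[p, m]\<close> correct the mismatch, and both lie
      in \<open>A\<close>.\<close>
    ultimately have "conjugate G (inv ?q \<otimes> ?p) ?l \<otimes> inv (commutator G ?p ?l) \<otimes> commutator G ?p ?m \<in> A"
      using Aops by blast
    moreover have "conjugate G (inv ?q \<otimes> ?p) ?l \<otimes> inv (commutator G ?p ?l) \<otimes> commutator G ?p ?m =
       inv (conjugate G ?q ?l) \<otimes> conjugate G ?p ?m"
      using mK by (simp add: group_word_simps)
    moreover have e: "conjugate G (conjugate G v n) x = conjugate G ?p ?m"
                  "conjugate G (conjugate G v n) y = conjugate G ?q ?l"
      using vK n x y by (simp_all add: group_word_simps)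
    moreover have "commutator G (conjugate G ?p ?m) k \<in> A" if k: "k \<in> K" for k
    proof -
      \<comment> \<open>\<open>[p^m, k]\<close> is the conjugate by \<open>m\<close> of
        \<open>[p, k']\<close>, where \<open>k'\<close> is \<open>k\<close> conjugated by
        \<open>inv m\<close>; normality keeps \<open>k'\<close> in \<open>K\<close>.\<close>
      have k': "conjugate G k (inv ?m) \<in> K" using k mK conjK by simp
      then have "conjugate G (commutator G ?p (conjugate G k (inv ?m))) ?m \<in> A"
        using v mK KN by (auto simp: commuting_stabilizer_def intro!: conjA)
      moreover have "conjugate G (commutator G ?p (conjugate G k (inv ?m))) ?m = commutator G (conjugate G ?p ?m) k"
        using mK k by (simp add: group_word_simps)
      ultimately show ?thesis by simp
    qed
    ultimately show ?thesis using vK n conjK by (simp add: commuting_stabilizer_def)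
  qed
  then show ?thesis using K sub by (auto simp: almost_normal_def commuting_stabilizer_def)
qed

text \<open>Passing from \<open>w\<close> to \<open>w \<otimes> v\<close> with \<open>v\<close> in
  \<open>K\<close> leaves, up to factors in \<open>A\<close>, only the stabilizer conditions on
  \<open>v\<close>.\<close>

lemma commuting_part_Int_l_coset:
  assumes AN: "almost_normal A N" and K: "K \<lhd> G" "finite (lcosets K)" "K \<subseteq> N"
    and y: "y \<in> carrier G" and x: "x \<in> carrier G" and g: "g \<in> carrier G"
    and w: "w \<in> commuting_part A K y x" "w \<in> g <# K"
  shows "commuting_part A K y x \<inter> (g <# K) = w <# commuting_stabilizer A K y x"
proof -
  let ?C = "commuting_stabilizer A K y x" and ?W = "commuting_part A K y x"
  have A: "subgroup A G" and conjA: "\<And>n a. n \<in> N \<Longrightarrow> a \<in> A \<Longrightarrow> conjugate G a n \<in> A"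
    using AN by (auto simp: almost_normal_def)
  have Ksub: "subgroup K G" using K(1) by (simp add: normal_imp_subgroup)
  have Kc [simp]: "k \<in> carrier G" if "k \<in> K" for k using that Ksub by (rule subgroup.mem_carrier[rotated])
  have Ac [simp]: "a \<in> carrier G" if "a \<in> A" for a using that A by (rule subgroup.mem_carrier[rotated])
  note conjK = conjugate_mem_normal[OF K(1)]
  have KN: "\<And>k. k \<in> K \<Longrightarrow> k \<in> N" using K by blast
  have wc [simp]: "w \<in> carrier G" using w by (simp add: commuting_part_def)
  have "g <# K = w <# K" using l_repr_independence[OF w(2) g Ksub] .
  moreover have "w \<otimes> v \<in> ?W \<longleftrightarrow> v \<in> ?C" if v: "v \<in> K" for v
  proof -
    let ?p = "conjugate G v x" and ?q = "conjugate G v y" and ?w = "conjugate G w x"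
    have p: "?p \<in> K" "?q \<in> K" using v x y conjK by auto
    have "commutator G w x \<in> y <# A" using w by (simp add: commuting_part_def)
    then have a: "inv y \<otimes> commutator G w x \<in> A" using mem_l_coset_iff[OF A y] x by simp
    then have a': "conjugate G (inv y \<otimes> commutator G w x) ?p \<in> A" using p KN conjA by blast
    \<comment> \<open>Moving \<open>inv v\<close> past \<open>inv y\<close> produces
      \<open>inv q\<close>, which is why the stabilizer involves the conjugate of \<open>v\<close>
      by \<open>y\<close> as well as by \<open>x\<close>.\<close>
    have "inv y \<otimes> commutator G (w \<otimes> v) x = (inv ?q \<otimes> ?p) \<otimes> conjugate G (inv y \<otimes> commutator G w x) ?p"
      using v x y by (simp add: group_word_simps)
    then have 1: "commutator G (w \<otimes> v) x \<in> y <# A \<longleftrightarrow> inv ?q \<otimes> ?p \<in> A"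
      using mem_l_coset_iff[OF A y] mult_mem_subgroup_iff(2)[OF A a'] x y v by simp
    have 2: "commutator G (conjugate G (w \<otimes> v) x) k \<in> A \<longleftrightarrow> commutator G ?p k \<in> A" if k: "k \<in> K" for k
    proof -
      have "commutator G ?w k \<in> A" using w k by (simp add: commuting_part_def)
      then have b: "conjugate G (commutator G ?w k) ?p \<in> A" using p KN conjA by blast
      have "commutator G (conjugate G (w \<otimes> v) x) k = conjugate G (commutator G ?w k) ?p \<otimes> commutator G ?p k"
        using v x k by (simp add: conjugate_mult commutator_mult_left)
      then show ?thesis using mult_mem_subgroup_iff(1)[OF A b] v x k by simp
    qed
    show ?thesis using 1 2 v by (auto simp: commuting_part_def commuting_stabilizer_def)
  qed
  ultimately show ?thesis
    by (auto simp: l_coset_def commuting_stabilizer_def)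
qed

text \<open>Makes \<open>commuting_part A K y\<close> constant on each coset of \<open>K\<close>:
  any two elements of a coset differ on the right by an element of \<open>K\<close>, so the two
  inclusions both follow.\<close>

lemma commuting_part_mult_right:
  assumes AN: "almost_normal A N" and K: "K \<lhd> G" "K \<subseteq> N"
    and y: "y \<in> carrier G" and x: "x \<in> carrier G" and k: "k \<in> K"
    and w: "w \<in> commuting_part A K y x"
  shows "w \<in> commuting_part A K y (x \<otimes> k)"
proof -
  have A: "subgroup A G" and conjA: "\<And>n a. n \<in> N \<Longrightarrow> a \<in> A \<Longrightarrow> conjugate G a n \<in> A"
    using AN by (auto simp: almost_normal_def)
  have Ksub: "subgroup K G" using K(1) by (simp add: normal_imp_subgroup)
  have Kc [simp]: "k \<in> carrier G" if "k \<in> K" for k using that Ksub by (rule subgroup.mem_carrier[rotated])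
  note conjK = conjugate_mem_normal[OF K(1)]
  have wc [simp]: "w \<in> carrier G" using w by (simp add: commuting_part_def)
  have "inv y \<otimes> commutator G w x \<in> A" "commutator G (conjugate G w x) k \<in> A"
    using w k mem_l_coset_iff[OF A y] x by (simp_all add: commuting_part_def)
  then have "(inv y \<otimes> commutator G w x) \<otimes> commutator G (conjugate G w x) k \<in> A"
    by (rule subgroup.m_closed[OF A])
  then have "inv y \<otimes> commutator G w (x \<otimes> k) \<in> A"
    using x y k by (simp add: commutator_mult_right(1) m_assoc)
  moreover have "commutator G (conjugate G w (x \<otimes> k)) k' \<in> A" if k': "k' \<in> K" for k'
  proof -
    have "conjugate G k' (inv k) \<in> K" using k k' conjK by simp
    then have "conjugate G (commutator G (conjugate G w x) (conjugate G k' (inv k))) k \<in> A"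
      using w k K by (auto simp: commuting_part_def intro!: conjA)
    moreover have "conjugate G (commutator G (conjugate G w x) (conjugate G k' (inv k))) k
        = commutator G (conjugate G w (x \<otimes> k)) k'"
      using x k k' by (simp add: group_word_simps)
    ultimately show ?thesis by simp
  qed
  ultimately show ?thesis using mem_l_coset_iff[OF A y] x k by (simp add: commuting_part_def)
qed

text \<open>With \<open>z = w\<^sup>u\<close> for some \<open>u\<close> in the set, \<open>T = {t \<in> N. [z, t] \<in> A}\<close> does it.\<close>

lemma noncommuting_part_subset_l_coset:
  assumes AN: "almost_normal A N" and K: "K \<subseteq> N"
    and y: "y \<in> carrier G" and w: "w \<in> carrier G" and h: "h \<in> carrier G"
  defines "S \<equiv> {x \<in> h <# N. commutator G w x \<in> y <# A \<and> w \<notin> commuting_part A K y x}"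
  assumes "S \<noteq> {}"
  shows "\<exists>u\<in>carrier G. \<exists>T. subgroup T G \<and> \<not> K \<subseteq> T \<and> S \<subseteq> u <# T"
proof -
  have A: "subgroup A G" and N: "N \<lhd> G" and conjA: "\<And>n a. n \<in> N \<Longrightarrow> a \<in> A \<Longrightarrow> conjugate G a n \<in> A"
    using AN by (auto simp: almost_normal_def)
  have Nsub: "subgroup N G" using N by (simp add: normal_imp_subgroup)
  have Nc [simp]: "k \<in> carrier G" if "k \<in> N" for k using that Nsub by (rule subgroup.mem_carrier[rotated])
  note Aops = subgroup.m_closed[OF A] subgroup.m_inv_closed[OF A]
  note Nops = subgroup.m_closed[OF Nsub] subgroup.m_inv_closed[OF Nsub]
  obtain u where u: "u \<in> S" using assms by blast
  then have uc [simp]: "u \<in> carrier G" using h l_coset_subset_G[of N h] subgroup.subset[OF Nsub]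
    by (auto simp: S_def)
  have hu: "h <# N = u <# N" using u l_repr_independence[OF _ h Nsub] by (simp add: S_def)
  let ?z = "conjugate G w u"
  define T where "T = {t \<in> N. commutator G ?z t \<in> A}"
  \<comment> \<open>Closure uses that conjugation by elements of \<open>N\<close> preserves
    \<open>A\<close>; hence \<open>t\<close> is confined to \<open>N\<close> and \<open>S\<close> to
    one coset of \<open>N\<close>.\<close>
  have "subgroup T G"
  proof (rule subgroupI)
    show "T \<subseteq> carrier G" by (auto simp: T_def)
    have "\<one> \<in> T" using w subgroup.one_closed[OF A] subgroup.one_closed[OF Nsub]
      by (simp add: T_def commutator_one)
    then show "T \<noteq> {}" by blast
    show "inv t \<in> T" if "t \<in> T" for t
      using that w Nops Aops conjA by (simp add: T_def commutator_inv_right)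
    show "t \<otimes> s \<in> T" if "t \<in> T" "s \<in> T" for t s
      using that w Nops Aops conjA by (simp add: T_def commutator_mult_right(2))
  qed
  \<comment> \<open>\<open>[w, u]\<close> lies in \<open>yA\<close> but \<open>w\<close> is outside
    \<open>commuting_part A K y u\<close>, so some \<open>k\<close> in \<open>K\<close> has
    \<open>[z, k]\<close> outside \<open>A\<close>.\<close>
  moreover have "\<not> K \<subseteq> T" using u w by (auto simp: T_def S_def commuting_part_def)
  moreover have "S \<subseteq> u <# T"
  proof
    fix x assume x: "x \<in> S"
    then obtain t where t: "t \<in> N" "x = u \<otimes> t" using hu by (auto simp: S_def l_coset_def)
    have "inv y \<otimes> commutator G w u \<in> A" "inv y \<otimes> commutator G w x \<in> A"
      using x u w mem_l_coset_iff[OF A y] t by (auto simp: S_def)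
    \<comment> \<open>The quotient of two commutators in \<open>yA\<close> lies in \<open>A\<close>;
      for \<open>x = ut\<close> it is \<open>[w^u, t]\<close>.\<close>
    then have "inv (inv y \<otimes> commutator G w u) \<otimes> (inv y \<otimes> commutator G w x) \<in> A"
      using Aops by blast
    moreover have "inv (inv y \<otimes> commutator G w u) \<otimes> (inv y \<otimes> commutator G w x) = commutator G ?z t"
      using t w y by (simp add: group_word_simps)
    ultimately show "x \<in> u <# T" using t by (auto simp: T_def l_coset_def)
  qed
  ultimately show ?thesis using uc by blast
qed

end

section \<open>Subgroups of bounded index\<close>

context group
begin

lemma lcosets_eq_image: "lcosets H = (\<lambda>x. x <# H) ` carrier G"
  by (auto simp: LCOSETS_def)

lemma l_coset_Int:
  assumes "H \<subseteq> carrier G" "K \<subseteq> carrier G" "x \<in> carrier G"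
  shows "x <# (H \<inter> K) = (x <# H) \<inter> (x <# K)"
  using assms unfolding l_coset_def by (auto simp: subset_iff)

lemma finite_lcosets_Int:
  assumes "finite (lcosets H)" "finite (lcosets K)" "H \<subseteq> carrier G" "K \<subseteq> carrier G"
  shows "finite (lcosets (H \<inter> K))"
proof (rule finite_subset)
  have "(x <# H) \<inter> (x <# K) \<in> (\<lambda>(X, Y). X \<inter> Y) ` ((lcosets H) \<times> (lcosets K))"
    if "x \<in> carrier G" for x
    using that by (intro image_eqI[of _ _ "(x <# H, x <# K)"]) (simp_all add: lcosets_eq_image)
  then show "lcosets (H \<inter> K) \<subseteq> (\<lambda>(X, Y). X \<inter> Y) ` ((lcosets H) \<times> (lcosets K))"
    using assms(3,4) by (simp add: lcosets_eq_image[of "H \<inter> K"] l_coset_Int image_subset_iff)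
qed (use assms in simp)

text \<open>The factor \<open>carrier G\<close> covers the empty family, whose intersection is the
  whole type.\<close>

lemma finite_lcosets_Inter:
  assumes "finite F" "\<And>H. H \<in> F \<Longrightarrow> finite (lcosets H) \<and> H \<subseteq> carrier G"
  shows "finite (lcosets (carrier G \<inter> \<Inter>F))"
  using assms
proof (induction F)
  case empty
  have "lcosets (carrier G) \<subseteq> {carrier G}"
    by (simp add: lcosets_eq_image image_subset_iff coset_join3 subgroup_self)
  then show ?case using finite_subset by auto
next
  case (insert H F)
  have "carrier G \<inter> \<Inter>(insert H F) = H \<inter> (carrier G \<inter> \<Inter>F)" by auto
  then show ?case using finite_lcosets_Int[of H "carrier G \<inter> \<Inter>F"] insert by auto
qed

text \<open>Finiteness is demanded separately because \<open>card\<close> of an infinite set is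
  0.\<close>

definition index_at_most :: "nat \<Rightarrow> 'a set \<Rightarrow> bool" where
  "index_at_most r H \<longleftrightarrow> subgroup H G \<and> finite (lcosets H) \<and> card (lcosets H) \<le> r"

text \<open>The left cosets of the conjugate subgroup are left cosets of \<open>H\<close> translated
  on the right by \<open>x\<close>, so there are no more of them.\<close>

lemma index_at_most_conjugate:
  assumes H: "index_at_most r H" and x: "x \<in> carrier G"
  shows "index_at_most r {g \<in> carrier G. x \<otimes> g \<otimes> inv x \<in> H}" (is "index_at_most r ?K")
proof -
  have sub: "subgroup H G" using H by (simp add: index_at_most_def)
  have Hc [simp]: "h \<in> carrier G" if "h \<in> H" for h using that sub by (rule subgroup.mem_carrier[rotated])
  have K: "subgroup ?K G"
  proof (rule subgroupI)
    have "\<one> \<in> ?K" using x subgroup.one_closed[OF sub] by simp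
    then show "?K \<noteq> {}" by blast
    show "inv g \<in> ?K" if g: "g \<in> ?K" for g
    proof -
      have "inv (x \<otimes> g \<otimes> inv x) \<in> H" using g by (intro subgroup.m_inv_closed[OF sub]) simp
      moreover have "inv (x \<otimes> g \<otimes> inv x) = x \<otimes> inv g \<otimes> inv x"
        using g x by (simp add: inv_mult_group m_assoc)
      ultimately show ?thesis using g by simp
    qed
    show "g \<otimes> g' \<in> ?K" if g: "g \<in> ?K" "g' \<in> ?K" for g g'
    proof -
      have "(x \<otimes> g \<otimes> inv x) \<otimes> (x \<otimes> g' \<otimes> inv x) \<in> H"
        using g by (simp add: subgroup.m_closed[OF sub])
      moreover have "(x \<otimes> g \<otimes> inv x) \<otimes> (x \<otimes> g' \<otimes> inv x) = x \<otimes> (g \<otimes> g') \<otimes> inv x"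
        using g x by (simp add: m_assoc inv_mult_cancel_left)
      ultimately show ?thesis using g by simp
    qed
  qed auto
  have "g <# ?K = (\<lambda>z. z \<otimes> x) ` ((g \<otimes> inv x) <# H)" if g: "g \<in> carrier G" for g
  proof -
    have "?K = (\<lambda>h. inv x \<otimes> h \<otimes> x) ` H"
    proof (intro equalityI subsetI)
      fix z assume "z \<in> ?K"
      then have z: "z \<in> carrier G" "x \<otimes> z \<otimes> inv x \<in> H" by auto
      have "z = inv x \<otimes> (x \<otimes> z \<otimes> inv x) \<otimes> x"
        using x z(1) by (simp add: m_assoc inv_mult_cancel_left)
      with z(2) show "z \<in> (\<lambda>h. inv x \<otimes> h \<otimes> x) ` H" by blast
    next
      fix z assume "z \<in> (\<lambda>h. inv x \<otimes> h \<otimes> x) ` H"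
      then obtain h where h: "h \<in> H" "z = inv x \<otimes> h \<otimes> x" by blast
      then have "x \<otimes> z \<otimes> inv x = h" using x by (simp add: m_assoc inv_mult_cancel_left)
      then show "z \<in> ?K" using h x by simp
    qed
    then show ?thesis using g x
      by (simp add: l_coset_def UNION_singleton_eq_range image_image m_assoc)
  qed
  then have "lcosets ?K \<subseteq> (\<lambda>X. (\<lambda>z. z \<otimes> x) ` X) ` (lcosets H)"
    using x by (auto simp: lcosets_eq_image)
  then have "finite (lcosets ?K) \<and> card (lcosets ?K) \<le> card (lcosets H)"
    using H by (auto simp: index_at_most_def intro: finite_surj surj_card_le)
  then show ?thesis using K H by (auto simp: index_at_most_def)
qed

text \<open>After labelling the cosets of \<open>H\<close> by numbers below \<open>r\<close>, the action of the generators on the labels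
  determines \<open>H\<close>.\<close>

lemma finite_index_at_most:
  assumes S: "finite S" "S \<subseteq> carrier G" "generate G S = carrier G"
  shows "finite {H. index_at_most r H}"
proof -
  have "\<exists>\<phi>. \<forall>H. index_at_most r H \<longrightarrow> inj_on (\<phi> H) (lcosets H) \<and> \<phi> H ` (lcosets H) \<subseteq> {..<r}"
  proof (rule choice, rule allI)
    fix H
    show "\<exists>\<phi>. index_at_most r H \<longrightarrow> inj_on \<phi> (lcosets H) \<and> \<phi> ` (lcosets H) \<subseteq> {..<r}"
      using card_le_inj[of "lcosets H" "{..<r}"] by (auto simp: index_at_most_def)
  qed
  then obtain \<phi> where \<phi>: "\<forall>H. index_at_most r H \<longrightarrow> inj_on (\<phi> H) (lcosets H) \<and> \<phi> H ` (lcosets H) \<subseteq> {..<r}"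
    by blast
  have inj: "inj_on (\<phi> H) (lcosets H)" and range: "\<phi> H ` (lcosets H) \<subseteq> {..<r}"
    if "index_at_most r H" for H using \<phi> that by simp_all
  define c where "c H g = \<phi> H (g <# H)" for H g
  have c_eq: "c H g = c H g' \<longleftrightarrow> g <# H = g' <# H"
    if "index_at_most r H" "g \<in> carrier G" "g' \<in> carrier G" for H g g'
    using inj[OF that(1)] that(2,3) by (auto simp: c_def lcosets_eq_image inj_on_def)
  have c_less: "c H g < r" if "index_at_most r H" "g \<in> carrier G" for H g
    using range[OF that(1)] that(2) by (auto simp: c_def lcosets_eq_image)
  \<comment> \<open>\<open>generate\<close> has a separate case for inverses of generators, so these
    get their own entries in the table below.\<close>
  define T where "T = S \<union> (\<lambda>s. inv s) ` S"
  have T: "finite T" "T \<subseteq> carrier G" using S by (auto simp: T_def)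
  \<comment> \<open>The table of the left action of \<open>T\<close> on coset labels, a subset of a
    finite set that does not depend on \<open>H\<close>.\<close>
  define D where "D H = {(s, i, j) \<in> T \<times> {..<r} \<times> {..<r}. \<exists>g\<in>carrier G. c H g = i \<and> c H (s \<otimes> g) = j}" for H
  have "inj_on (\<lambda>H. (D H, c H \<one>)) {H. index_at_most r H}"
  proof (rule inj_onI, clarsimp)
    fix H K assume HK: "index_at_most r H" "index_at_most r K" and D: "D H = D K" and c1: "c H \<one> = c K \<one>"
    have sub: "subgroup H G" "subgroup K G" using HK by (auto simp: index_at_most_def)
    have mult: "c H (s \<otimes> g) = c K (s \<otimes> g)" if s: "s \<in> T" and g: "g \<in> carrier G" and e: "c H g = c K g" for s g
    proof -
      have sc: "s \<in> carrier G" using s T by auto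
      have "(s, c H g, c H (s \<otimes> g)) \<in> D H" using s g sc HK c_less by (auto simp: D_def)
      then obtain g' where g': "g' \<in> carrier G" "c K g' = c H g" "c K (s \<otimes> g') = c H (s \<otimes> g)"
        unfolding D by (auto simp: D_def)
      then have "g' <# K = g <# K" using c_eq[OF HK(2) g'(1) g] e by simp
      then have "s <# (g' <# K) = s <# (g <# K)" by simp
      then have "(s \<otimes> g') <# K = (s \<otimes> g) <# K"
        using lcos_m_assoc[OF subgroup.subset[OF sub(2)] sc] g g' by simp
      then show ?thesis using g' by (simp add: c_def)
    qed
    \<comment> \<open>Keeping \<open>g\<close> general lets the action of a product be composed from
      the actions of its factors.\<close>
    have "\<forall>g\<in>carrier G. c H g = c K g \<longrightarrow> c H (a \<otimes> g) = c K (a \<otimes> g)" if "a \<in> generate G S" for a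
      using that
    proof induction
      case one
      then show ?case by simp
    next
      case (incl h)
      then show ?case using mult by (simp add: T_def)
    next
      case (inv h)
      then show ?case using mult by (simp add: T_def)
    next
      case (eng a b)
      then have "a \<in> carrier G" "b \<in> carrier G" using S by auto
      then show ?case using eng by (auto simp: m_assoc)
    qed
    \<comment> \<open>The labels agree at \<open>\<one>\<close>, hence at every element. A subgroup
      consists of the elements sharing the label of \<open>\<one>\<close>, so the two subgroups
      coincide.\<close>
    then have c: "c H a = c K a" if "a \<in> carrier G" for a
      using bspec[OF _ one_closed] that c1 S(3) by fastforce
    have "g \<in> L \<longleftrightarrow> c L g = c L \<one>" if "index_at_most r L" "g \<in> carrier G" for L g
    proof -
      have L: "subgroup L G" using that by (simp add: index_at_most_def)
      have "\<one> <# L = L" using lcos_mult_one[OF subgroup.subset[OF L]] .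
      then show ?thesis
        using c_eq[OF that one_closed] coset_join3[OF that(2) L] lcos_self[OF that(2) L] by auto
    qed
    then have "g \<in> H \<longleftrightarrow> g \<in> K" if "g \<in> carrier G" for g using HK c that by simp
    then show "H = K" using sub[THEN subgroup.subset] by blast
  qed
  moreover have "(\<lambda>H. (D H, c H \<one>)) ` {H. index_at_most r H} \<subseteq> Pow (T \<times> {..<r} \<times> {..<r}) \<times> {..<r}"
    using c_less by (auto simp: D_def)
  ultimately show ?thesis
    by (rule inj_on_finite) (use T in auto)
qed

text \<open>The intersection of all subgroups up to a certain index works: finite generation makes
  the family finite, and its stability under conjugation makes the intersection normal.\<close>

lemma ex_normal_subset_index_at_most:
  assumes S: "finite S" "S \<subseteq> carrier G" "generate G S = carrier G"
    and N: "N \<lhd> G" "finite (lcosets N)"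
  shows "\<exists>K. K \<lhd> G \<and> finite (lcosets K) \<and> K \<subseteq> N \<and> (\<forall>H. index_at_most r H \<longrightarrow> K \<subseteq> H)"
proof -
  \<comment> \<open>The maximum puts \<open>N\<close> into the family, which makes the family
    nonempty and gives \<open>K \<subseteq> N\<close>.\<close>
  define F where "F = {H. index_at_most (max r (card (lcosets N))) H}"
  have Nsub: "subgroup N G" using N by (simp add: normal_imp_subgroup)
  have NF: "N \<in> F" using N Nsub by (simp add: F_def index_at_most_def)
  have F: "subgroup H G" if "H \<in> F" for H using that by (simp add: F_def index_at_most_def)
  define K where "K = \<Inter>F"
  have "finite F" unfolding F_def by (rule finite_index_at_most[OF S])
  then have "finite (lcosets (carrier G \<inter> \<Inter>F))"
    by (rule finite_lcosets_Inter) (use F[THEN subgroup.subset] in \<open>simp add: F_def index_at_most_def\<close>)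
  moreover have "carrier G \<inter> \<Inter>F = K" using NF subgroup.subset[OF Nsub] by (auto simp: K_def)
  ultimately have "finite (lcosets K)" by simp
  moreover have "subgroup K G" unfolding K_def using F NF by (intro subgroups_Inter) auto
  moreover have "x \<otimes> h \<otimes> inv x \<in> K" if x: "x \<in> carrier G" and h: "h \<in> K" for x h
    unfolding K_def
  proof
    fix H assume "H \<in> F"
    then have "{g \<in> carrier G. x \<otimes> g \<otimes> inv x \<in> H} \<in> F"
      using index_at_most_conjugate[OF _ x] by (simp add: F_def)
    then show "x \<otimes> h \<otimes> inv x \<in> H" using h by (auto simp: K_def)
  qed
  moreover have "K \<subseteq> H" if "index_at_most r H" for H
    using that by (auto simp: K_def F_def index_at_most_def)
  ultimately show ?thesis using NF by (intro exI[of _ K]) (auto simp: normal_inv_iff K_def)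
qed

end

section \<open>The law of a simple commutator\<close>

text \<open>Every element is the product of a finite word in generators and their inverses.
  Countability makes every set of pairs measurable for the product of two measures on
  \<open>G\<close>.\<close>

lemma finitely_generated_countable:
  assumes "finitely_generated_group G"
  shows "countable (carrier G)"
proof -
  obtain S where G: "group G" and S: "finite S" "S \<subseteq> carrier G" "generate G S = carrier G"
    using assms by (auto simp: finitely_generated_group_def)
  interpret group G by (rule G)
  define T where "T = S \<union> (\<lambda>s. inv\<^bsub>G\<^esub> s) ` S"
  have T: "countable T" "T \<subseteq> carrier G" using S by (auto simp: T_def intro: countable_finite)
  let ?p = "\<lambda>l. foldr (\<lambda>x y. x \<otimes>\<^bsub>G\<^esub> y) l \<one>\<^bsub>G\<^esub>"
  have closed: "?p l \<in> carrier G" if "l \<in> lists T" for l using that T by (induction l) auto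
  have append: "?p (l @ l') = ?p l \<otimes>\<^bsub>G\<^esub> ?p l'" if "l \<in> lists T" "l' \<in> lists T" for l l'
    using that(1)
  proof induction
    case Nil
    then show ?case using closed[OF that(2)] by simp
  next
    case (Cons a l)
    then have "a \<in> carrier G" using T by auto
    then show ?case using Cons closed that(2) by (simp add: m_assoc del: foldr_append)
  qed
  have single: "a \<in> ?p ` lists T" if "a \<in> T" for a
    using that T by (intro image_eqI[of _ _ "[a]"]) auto
  have "a \<in> ?p ` lists T" if "a \<in> generate G S" for a
    using that
  proof induction
    case one
    show ?case by (intro image_eqI[of _ _ "[]"]) auto
  next
    case (eng a b)
    then obtain l l' where "l \<in> lists T" "l' \<in> lists T" "a = ?p l" "b = ?p l'" by auto
    then show ?case using append by (intro image_eqI[of _ _ "l @ l'"]) auto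
  qed (use single in \<open>simp_all add: T_def\<close>)
  then have "carrier G \<subseteq> ?p ` lists T" using S by auto
  then show ?thesis using T by (meson countable_lists countable_image countable_subset)
qed

text \<open>The law of \<open>[x\<^sub>0, ..., x\<^sub>k]\<close> for independent entries, built so
  that each step involves just two independent variables. As second argument of
  \<open>distr\<close>, \<open>\<mu>\<close> only supplies the full power set as
  sigma-algebra.\<close>

primrec commutator_law :: "('a, 'b) monoid_scheme \<Rightarrow> 'a measure \<Rightarrow> nat \<Rightarrow> 'a measure" where
  "commutator_law G \<mu> 0 = \<mu>"
| "commutator_law G \<mu> (Suc k) =
     distr (commutator_law G \<mu> k \<Otimes>\<^sub>M \<mu>) \<mu> (\<lambda>(w, x). commutator G w x)"

lemma sets_pair_prob_measure_on:
  assumes "countable (carrier G)" "prob_measure_on G \<nu>" "prob_measure_on G \<mu>"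
  shows "sets (\<nu> \<Otimes>\<^sub>M \<mu>) = Pow (carrier G \<times> carrier G)"
  using assms by (intro sets_pair_countable) (auto simp: prob_measure_on_def)

context group
begin

lemma measurable_commutator:
  assumes "countable (carrier G)" "prob_measure_on G \<nu>" "prob_measure_on G \<mu>"
  shows "(\<lambda>(w, x). commutator G w x) \<in> measurable (\<nu> \<Otimes>\<^sub>M \<mu>) \<mu>"
proof (rule measurableI)
  show "(case z of (w, x) \<Rightarrow> commutator G w x) \<in> space \<mu>" if "z \<in> space (\<nu> \<Otimes>\<^sub>M \<mu>)" for z
    using that assms by (auto simp: space_pair_measure prob_measure_on_def commutator_def)
  show "(\<lambda>(w, x). commutator G w x) -` A \<inter> space (\<nu> \<Otimes>\<^sub>M \<mu>) \<in> sets (\<nu> \<Otimes>\<^sub>M \<mu>)" if "A \<in> sets \<mu>" for A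
    using assms by (auto simp: sets_pair_prob_measure_on[OF assms] space_pair_measure prob_measure_on_def)
qed

lemma prob_measure_on_commutator_law:
  assumes G: "countable (carrier G)" and \<mu>: "prob_measure_on G \<mu>"
  shows "prob_measure_on G (commutator_law G \<mu> k)"
proof (induction k)
  case (Suc k)
  interpret A: prob_space "commutator_law G \<mu> k" using Suc by (simp add: prob_measure_on_def)
  interpret B: prob_space \<mu> using \<mu> by (simp add: prob_measure_on_def)
  interpret pair_prob_space "commutator_law G \<mu> k" \<mu> ..
  have "prob_space (commutator_law G \<mu> (Suc k))"
    by (simp add: prob_space_distr measurable_commutator[OF G Suc \<mu>])
  then show ?case using \<mu> by (simp add: prob_measure_on_def)
qed (use \<mu> in simp)

text \<open>Identifies the recursive law with the law under the product measure, by splitting off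
  the last entry. \<open>f\<close> stays arbitrary because the induction hypothesis is applied to
  the inner integral.\<close>

lemma nn_integral_simple_commutator:
  fixes f :: "'a \<Rightarrow> ennreal"
  assumes G: "countable (carrier G)" and \<mu>: "prob_measure_on G \<mu>"
  shows "(\<lambda>x. simple_commutator G x k) \<in> measurable (Pi\<^sub>M {..k} (\<lambda>_. \<mu>)) \<mu> \<and>
    (\<integral>\<^sup>+x. f (simple_commutator G x k) \<partial>Pi\<^sub>M {..k} (\<lambda>_. \<mu>)) = (\<integral>\<^sup>+w. f w \<partial>commutator_law G \<mu> k)"
proof (induction k arbitrary: f)
  interpret B: prob_space \<mu> using \<mu> by (simp add: prob_measure_on_def)
  interpret P: product_prob_space "\<lambda>_. \<mu>" UNIV ..
  have any: "g \<in> borel_measurable \<mu>" for g :: "'a \<Rightarrow> ennreal"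
    using \<mu> by (intro measurableI) (auto simp: prob_measure_on_def)
  {
    case 0
    have "{..0} = {0 :: nat}" by auto
    then show ?case using P.product_nn_integral_singleton[of f 0] any
      by (auto intro!: measurable_component_singleton)
  }
  {
    case (Suc k)
    have eq: "{..Suc k} = insert (Suc k) {..k}" by auto
    have IH: "(\<lambda>x. simple_commutator G x k) \<in> measurable (Pi\<^sub>M {..k} (\<lambda>_. \<mu>)) \<mu>" using Suc by blast
    have cong: "simple_commutator G x k = simple_commutator G x' k" if "\<And>i. i \<le> k \<Longrightarrow> x i = x' i" for x x' k
      using that by (induction k) auto
    \<comment> \<open>The commutator up to \<open>k\<close> sees only the coordinates up to
      \<open>k\<close>, so its measurability transfers along the restriction map.\<close>
    have res: "(\<lambda>x. restrict x {..k}) \<in> measurable (Pi\<^sub>M {..Suc k} (\<lambda>_. \<mu>)) (Pi\<^sub>M {..k} (\<lambda>_. \<mu>))"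
      by (rule measurable_restrict_subset) auto
    have sc: "simple_commutator G (restrict x {..k}) k = simple_commutator G x k" for x
      by (rule cong) auto
    have m1: "(\<lambda>x. simple_commutator G x k) \<in> measurable (Pi\<^sub>M {..Suc k} (\<lambda>_. \<mu>)) \<mu>"
      using measurable_compose[OF res IH] unfolding sc .
    have "(\<lambda>x. (simple_commutator G x k, x (Suc k))) \<in> measurable (Pi\<^sub>M {..Suc k} (\<lambda>_. \<mu>)) (\<mu> \<Otimes>\<^sub>M \<mu>)"
      by (intro measurable_Pair m1 measurable_component_singleton) auto
    from measurable_compose[OF this measurable_commutator[OF G \<mu> \<mu>]]
    have m: "(\<lambda>x. simple_commutator G x (Suc k)) \<in> measurable (Pi\<^sub>M {..Suc k} (\<lambda>_. \<mu>)) \<mu>" by simp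
    note law = prob_measure_on_commutator_law[OF G \<mu>, of k]
    have "(\<integral>\<^sup>+x. f (simple_commutator G x (Suc k)) \<partial>Pi\<^sub>M {..Suc k} (\<lambda>_. \<mu>))
       = (\<integral>\<^sup>+x. (\<integral>\<^sup>+y. f (simple_commutator G (x(Suc k := y)) (Suc k)) \<partial>\<mu>) \<partial>Pi\<^sub>M {..k} (\<lambda>_. \<mu>))"
      unfolding eq by (rule P.product_nn_integral_insert)
        (use measurable_compose[OF m any] eq in auto)
    also have "\<dots> = (\<integral>\<^sup>+x. (\<integral>\<^sup>+y. f (commutator G (simple_commutator G x k) y) \<partial>\<mu>) \<partial>Pi\<^sub>M {..k} (\<lambda>_. \<mu>))"
    proof -
      have "simple_commutator G (x(Suc k := y)) k = simple_commutator G x k" for x y by (rule cong) auto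
      then show ?thesis by simp
    qed
    also have "\<dots> = (\<integral>\<^sup>+w. (\<integral>\<^sup>+y. f (commutator G w y) \<partial>\<mu>) \<partial>commutator_law G \<mu> k)"
      using Suc[of "\<lambda>w. \<integral>\<^sup>+y. f (commutator G w y) \<partial>\<mu>"] by blast
    also have "\<dots> = (\<integral>\<^sup>+z. f (case z of (w, y) \<Rightarrow> commutator G w y) \<partial>(commutator_law G \<mu> k \<Otimes>\<^sub>M \<mu>))"
      using B.nn_integral_fst[OF measurable_compose[OF measurable_commutator[OF G law \<mu>] any], of f]
      by simp
    also have "\<dots> = (\<integral>\<^sup>+w. f w \<partial>commutator_law G \<mu> (Suc k))"
      using nn_integral_distr[OF measurable_commutator[OF G law \<mu>], of f] any[of f] by simp
    finally show ?case using m by blast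
  }
qed

lemma dc_eq_measure_commutator_law:
  assumes G: "countable (carrier G)" and \<mu>: "prob_measure_on G \<mu>"
  shows "dc k G \<mu> = measure (commutator_law G \<mu> k) {\<one>}"
proof -
  let ?P = "Pi\<^sub>M {..k} (\<lambda>_. \<mu>)" and ?S = "{x \<in> space (Pi\<^sub>M {..k} (\<lambda>_. \<mu>)). simple_commutator G x k = \<one>}"
  have law: "prob_measure_on G (commutator_law G \<mu> k)" by (rule prob_measure_on_commutator_law[OF G \<mu>])
  have m: "(\<lambda>x. simple_commutator G x k) \<in> measurable ?P \<mu>"
    using nn_integral_simple_commutator[OF G \<mu>] by blast
  have one: "{\<one>} \<in> sets \<mu>" "{\<one>} \<in> sets (commutator_law G \<mu> k)"
    using \<mu> law by (auto simp: prob_measure_on_def)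
  have "?S = (\<lambda>x. simple_commutator G x k) -` {\<one>} \<inter> space ?P" by auto
  then have S: "?S \<in> sets ?P" using measurable_sets[OF m one(1)] by simp
  have "emeasure ?P ?S = (\<integral>\<^sup>+x. indicator ?S x \<partial>?P)" using S by simp
  also have "\<dots> = (\<integral>\<^sup>+x. indicator {\<one>} (simple_commutator G x k) \<partial>?P)"
    by (intro nn_integral_cong) (auto simp: indicator_def)
  also have "\<dots> = emeasure (commutator_law G \<mu> k) {\<one>}"
    using nn_integral_simple_commutator[OF G \<mu>, of k "indicator {\<one>}"] one by simp
  finally show ?thesis by (simp add: dc_def Let_def measure_def)
qed

end

section \<open>Convergence along index-uniform measures\<close>

text \<open>For use when approximations are known but no candidate limit is: the values for errors
  \<open>1 / Suc n\<close> form a Cauchy sequence, and its limit is the limit of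
  \<open>f\<close>.\<close>

lemma ex_tendsto_if_eventually_close:
  fixes f :: "'a \<Rightarrow> real"
  assumes "\<And>\<epsilon>. \<epsilon> > 0 \<Longrightarrow> \<exists>l. \<forall>\<^sub>F x in F. \<bar>f x - l\<bar> \<le> \<epsilon>"
  shows "\<exists>L. (f \<longlongrightarrow> L) F"
\<comment> \<open>Off the trivial filter, two eventual bounds hold at a common point, which compares
  \<open>l m\<close> with \<open>l n\<close>. Along the trivial filter everything converges.\<close>
proof (cases "F = bot")
  case False
  have "\<exists>l. \<forall>n. \<forall>\<^sub>F x in F. \<bar>f x - l n\<bar> \<le> 1 / Suc n"
    using assms by (intro choice) simp
  then obtain l where l: "\<And>n. \<forall>\<^sub>F x in F. \<bar>f x - l n\<bar> \<le> 1 / Suc n" by blast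
  have close: "\<bar>l m - l n\<bar> \<le> 1 / Suc m + 1 / Suc n" for m n
  proof -
    have "\<exists>x. \<bar>f x - l m\<bar> \<le> 1 / Suc m \<and> \<bar>f x - l n\<bar> \<le> 1 / Suc n"
      using eventually_happens'[OF False eventually_conj[OF l l]] by blast
    then show ?thesis by linarith
  qed
  have small: "\<exists>N. \<forall>n\<ge>N. 1 / Suc n < e" if "e > 0" for e :: real
    using order_tendstoD(2)[OF lim_inverse_n' [THEN LIMSEQ_Suc] that]
    by (simp add: eventually_sequentially)
  have "Cauchy l"
  proof (rule metric_CauchyI)
    fix e :: real assume "e > 0"
    then obtain N where N: "\<And>n. n \<ge> N \<Longrightarrow> 1 / Suc n < e / 2" using small[of "e / 2"] by auto
    show "\<exists>M. \<forall>m\<ge>M. \<forall>n\<ge>M. dist (l m) (l n) < e"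
    proof (intro exI allI impI)
      fix m n assume "m \<ge> N" "n \<ge> N"
      then show "dist (l m) (l n) < e"
        using N[of m] N[of n] close[of m n] unfolding dist_real_def by linarith
    qed
  qed
  then obtain L where L: "l \<longlonglongrightarrow> L" using Cauchy_convergent by (auto simp: convergent_def)
  have "(f \<longlongrightarrow> L) F"
  proof (rule tendstoI)
    fix e :: real assume e: "e > 0"
    then obtain N where N: "\<And>n. n \<ge> N \<Longrightarrow> 1 / Suc n < e / 2" using small[of "e / 2"] by auto
    obtain N' where N': "\<And>n. n \<ge> N' \<Longrightarrow> dist (l n) L < e / 2"
      using tendstoD[OF L, of "e / 2"] e by (auto simp: eventually_sequentially)
    show "\<forall>\<^sub>F x in F. dist (f x) L < e"
      using l[of "max N N'"]
    proof eventually_elim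
      case (elim x)
      then show ?case
        using N[of "max N N'"] N'[of "max N N'"] max.cobounded1[of N N'] max.cobounded2[of N' N]
        unfolding dist_real_def by linarith
    qed
  qed
  then show ?thesis by blast
qed simp

text \<open>Convergence along one filter of measures gives a limit that is the same for all sequences.\<close>

definition index_filter :: "('a, 'b) monoid_scheme \<Rightarrow> 'a measure filter" where
  "index_filter G = (INF \<epsilon>\<in>{0<..}. principal {\<mu>. prob_measure_on G \<mu> \<and>
     (\<forall>x\<in>carrier G. \<forall>H. subgroup H G \<longrightarrow> \<bar>measure \<mu> (x <#\<^bsub>G\<^esub> H) - inverse_index G H\<bar> < \<epsilon>)})"

lemma eventually_index_filter:
  assumes "\<epsilon> > 0"
  shows "\<forall>\<^sub>F \<mu> in index_filter G. prob_measure_on G \<mu> \<and>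
    (\<forall>x\<in>carrier G. \<forall>H. subgroup H G \<longrightarrow> \<bar>measure \<mu> (x <#\<^bsub>G\<^esub> H) - inverse_index G H\<bar> < \<epsilon>)"
proof -
  let ?S = "{\<mu>. prob_measure_on G \<mu> \<and>
    (\<forall>x\<in>carrier G. \<forall>H. subgroup H G \<longrightarrow> \<bar>measure \<mu> (x <#\<^bsub>G\<^esub> H) - inverse_index G H\<bar> < \<epsilon>)}"
  have "index_filter G \<le> principal ?S"
    unfolding index_filter_def using assms by (intro INF_lower) simp
  moreover have "eventually (\<lambda>\<mu>. \<mu> \<in> ?S) (principal ?S)" by (simp add: eventually_principal)
  ultimately have "eventually (\<lambda>\<mu>. \<mu> \<in> ?S) (index_filter G)" by (rule filter_leD)
  then show ?thesis by simp
qed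

lemma eventually_prob_measure_on: "\<forall>\<^sub>F \<mu> in index_filter G. prob_measure_on G \<mu>"
  using eventually_index_filter[of 1 G] by (auto elim: eventually_mono)

lemma tendsto_measure_l_coset:
  assumes "x \<in> carrier G" "subgroup H G"
  shows "((\<lambda>\<mu>. measure \<mu> (x <#\<^bsub>G\<^esub> H)) \<longlongrightarrow> inverse_index G H) (index_filter G)"
proof (rule tendstoI)
  fix e :: real assume "e > 0"
  from eventually_index_filter[OF this, of G]
  show "\<forall>\<^sub>F \<mu> in index_filter G. dist (measure \<mu> (x <#\<^bsub>G\<^esub> H)) (inverse_index G H) < e"
    by eventually_elim (use assms in \<open>simp add: dist_real_def\<close>)
qed

text \<open>Uniformity over all cosets of all subgroups puts \<open>M n\<close> eventually into each
  basic set of the filter.\<close>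

lemma filterlim_index_filter:
  assumes "measures_index_uniformly G M"
  shows "filterlim M (index_filter G) sequentially"
  unfolding index_filter_def filterlim_INF filterlim_principal
proof
  fix e :: real assume "e \<in> {0<..}"
  then have "\<forall>\<^sub>F n in sequentially. \<forall>z\<in>carrier G \<times> {H. subgroup H G}.
      dist (case z of (x, H) \<Rightarrow> measure (M n) (x <#\<^bsub>G\<^esub> H)) (case z of (x, H) \<Rightarrow> inverse_index G H) < e"
    using assms by (auto simp: measures_index_uniformly_def uniform_limit_iff)
  then show "\<forall>\<^sub>F n in sequentially. M n \<in> {\<mu>. prob_measure_on G \<mu> \<and>
     (\<forall>x\<in>carrier G. \<forall>H. subgroup H G \<longrightarrow> \<bar>measure \<mu> (x <#\<^bsub>G\<^esub> H) - inverse_index G H\<bar> < e)}"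
    by eventually_elim (use assms in \<open>simp add: measures_index_uniformly_def dist_real_def\<close>)
qed

context group
begin

section \<open>Left cosets as a partition, and the error of one commutator step\<close>

lemma l_coset_eqI:
  assumes "subgroup H G" "X \<in> lcosets H" "x \<in> X"
  shows "x \<in> carrier G" "X = x <# H"
proof -
  obtain g where g: "g \<in> carrier G" "X = g <# H" using assms(2) by (auto simp: lcosets_eq_image)
  then show "x \<in> carrier G" using l_coset_subset_G[OF subgroup.subset[OF assms(1)]] assms(3) by blast
  show "X = x <# H" using l_repr_independence[of x g H] g assms by simp
qed

lemma some_mem_lcosets:
  assumes "subgroup H G" "X \<in> lcosets H"
  shows "(SOME x. x \<in> X) \<in> X"
proof -
  obtain g where "g \<in> carrier G" "X = g <# H" using assms(2) by (auto simp: lcosets_eq_image)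
  then have "g \<in> X" using lcos_self[OF _ assms(1)] by simp
  then show ?thesis by (rule someI)
qed

lemma disjoint_lcosets:
  assumes "subgroup H G" "X \<in> lcosets H" "Y \<in> lcosets H" "X \<noteq> Y"
  shows "X \<inter> Y = {}"
  using l_coset_eqI(2)[OF assms(1,2)] l_coset_eqI(2)[OF assms(1,3)] assms(4) by fastforce

lemma measure_eq_sum_lcosets:
  assumes "prob_measure_on G \<nu>" "subgroup H G" "finite (lcosets H)" "B \<subseteq> carrier G"
  shows "measure \<nu> B = (\<Sum>X\<in>lcosets H. measure \<nu> (B \<inter> X))"
proof -
  interpret prob_space \<nu> using assms by (simp add: prob_measure_on_def)
  have "(\<Union>X\<in>lcosets H. B \<inter> X) = B" using lcosets_part_G[OF assms(2)] assms(4) by blast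
  moreover have "disjoint_family_on (\<lambda>X. B \<inter> X) (lcosets H)"
    using disjoint_lcosets[OF assms(2)] by (force simp: disjoint_family_on_def)
  moreover have "(\<lambda>X. B \<inter> X) ` (lcosets H) \<subseteq> sets \<nu>"
    using assms by (auto simp: prob_measure_on_def)
  ultimately show ?thesis
    using finite_measure_finite_Union[OF assms(3), of "\<lambda>X. B \<inter> X"] by simp
qed

text \<open>Each coset of \<open>N\<close> meets the set in nothing or in part of a coset of some
  \<open>T\<close> not containing \<open>K\<close>, and so contributes at most
  \<open>\<delta>\<close>.\<close>

lemma measure_noncommuting_le:
  fixes \<delta> :: real
  assumes \<mu>: "prob_measure_on G \<mu>"
    and AN: "almost_normal A N" and K: "K \<subseteq> N" and y: "y \<in> carrier G" and w: "w \<in> carrier G"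
    and \<delta>: "\<delta> \<ge> 0" "\<And>u T. u \<in> carrier G \<Longrightarrow> subgroup T G \<Longrightarrow> \<not> K \<subseteq> T \<Longrightarrow> measure \<mu> (u <# T) \<le> \<delta>"
  shows "measure \<mu> {x \<in> carrier G. commutator G w x \<in> y <# A \<and> w \<notin> commuting_part A K y x}
    \<le> card (lcosets N) * \<delta>" (is "measure \<mu> ?S \<le> _")
proof -
  interpret prob_space \<mu> using \<mu> by (simp add: prob_measure_on_def)
  have N: "subgroup N G" "finite (lcosets N)"
    using AN by (auto simp: almost_normal_def normal_imp_subgroup)
  have "measure \<mu> ?S = (\<Sum>X\<in>lcosets N. measure \<mu> (?S \<inter> X))"
    by (rule measure_eq_sum_lcosets[OF \<mu> N]) auto
  also have "\<dots> \<le> sum (\<lambda>_. \<delta>) (lcosets N)"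
  proof (rule sum_mono)
    fix X assume "X \<in> lcosets N"
    then obtain h where h: "h \<in> carrier G" "X = h <# N" by (auto simp: lcosets_eq_image)
    have "h <# N \<subseteq> carrier G" using l_coset_subset_G[OF subgroup.subset[OF N(1)] h(1)] .
    then have S: "?S \<inter> X = {x \<in> h <# N. commutator G w x \<in> y <# A \<and> w \<notin> commuting_part A K y x}"
      unfolding h by auto
    show "measure \<mu> (?S \<inter> X) \<le> \<delta>"
    proof (cases "?S \<inter> X = {}")
      case True
      then show ?thesis using \<delta>(1) by (simp only: measure_empty)
    next
      case False
      then obtain u T where uT: "u \<in> carrier G" "subgroup T G" "\<not> K \<subseteq> T" "?S \<inter> X \<subseteq> u <# T"
        using noncommuting_part_subset_l_coset[OF AN K y w h(1)] unfolding S by blast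
      have "u <# T \<in> sets \<mu>"
        using l_coset_subset_G[OF subgroup.subset[OF uT(2)] uT(1)] \<mu> by (simp add: prob_measure_on_def)
      then have "measure \<mu> (?S \<inter> X) \<le> measure \<mu> (u <# T)"
        using uT(4) by (rule finite_measure_mono[rotated])
      then show ?thesis using \<delta>(2)[OF uT(1-3)] by linarith
    qed
  qed
  also have "\<dots> = card (lcosets N) * \<delta>" by simp
  finally show ?thesis .
qed

text \<open>Splits the event \<open>[w, x] \<in> yA\<close> by whether it persists on the whole
  coset of \<open>x\<close> modulo \<open>K\<close>. The persistent part is the sum, the rest is the
  error.\<close>

lemma measure_commutator_l_coset_approx:
  fixes \<delta> :: real
  assumes G: "countable (carrier G)" and \<nu>: "prob_measure_on G \<nu>" and \<mu>: "prob_measure_on G \<mu>"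
    and AN: "almost_normal A N" and K: "K \<lhd> G" "finite (lcosets K)" "K \<subseteq> N" and y: "y \<in> carrier G"
    and \<delta>: "\<delta> \<ge> 0" "\<And>u T. u \<in> carrier G \<Longrightarrow> subgroup T G \<Longrightarrow> \<not> K \<subseteq> T \<Longrightarrow> measure \<mu> (u <# T) \<le> \<delta>"
  shows "\<bar>measure (distr (\<nu> \<Otimes>\<^sub>M \<mu>) \<mu> (\<lambda>(w, x). commutator G w x)) (y <# A) -
    (\<Sum>X\<in>lcosets K. measure \<nu> (commuting_part A K y (SOME x. x \<in> X)) * measure \<mu> X)\<bar>
    \<le> card (lcosets N) * \<delta>"
proof -
  interpret A: prob_space \<nu> using \<nu> by (simp add: prob_measure_on_def)
  interpret B: prob_space \<mu> using \<mu> by (simp add: prob_measure_on_def)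
  interpret P: pair_prob_space \<nu> \<mu> ..
  have A: "subgroup A G" using AN by (simp add: almost_normal_def)
  have Ksub: "subgroup K G" using K(1) by (rule normal_imp_subgroup)
  let ?P = "\<nu> \<Otimes>\<^sub>M \<mu>" and ?part = "commuting_part A K y"
  have sets: "sets ?P = Pow (carrier G \<times> carrier G)" by (rule sets_pair_prob_measure_on[OF G \<nu> \<mu>])
  have sets\<nu>: "sets \<nu> = Pow (carrier G)" "space \<nu> = carrier G"
    and sets\<mu>: "sets \<mu> = Pow (carrier G)" "space \<mu> = carrier G"
    using \<nu> \<mu> by (auto simp: prob_measure_on_def)
  define E where "E = {(w, x). w \<in> carrier G \<and> x \<in> carrier G \<and> commutator G w x \<in> y <# A}"
  define E1 where "E1 = {(w, x). w \<in> ?part x \<and> x \<in> carrier G}"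
  have E: "E \<in> sets ?P" "E1 \<in> sets ?P" "E1 \<subseteq> E"
    unfolding sets by (auto simp: E_def E1_def commuting_part_def)
  have yA: "y <# A \<in> sets \<mu>"
    using l_coset_subset_G[OF subgroup.subset[OF A] y] by (simp add: sets\<mu>)
  have "(\<lambda>(w, x). commutator G w x) -` (y <# A) \<inter> space ?P = E"
    by (auto simp: E_def space_pair_measure sets\<nu> sets\<mu>)
  then have "measure (distr ?P \<mu> (\<lambda>(w, x). commutator G w x)) (y <# A) = measure ?P E"
    using measure_distr[OF measurable_commutator[OF G \<nu> \<mu>] yA] by simp
  also have "\<dots> = measure ?P E1 + measure ?P (E - E1)"
    using P.finite_measure_Diff[OF E] by simp
  also have "measure ?P E1 = (\<Sum>X\<in>lcosets K. measure \<nu> (?part (SOME x. x \<in> X)) * measure \<mu> X)"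
  proof -
    have some: "(SOME x. x \<in> X) \<in> X" if "X \<in> lcosets K" for X
      using some_mem_lcosets[OF Ksub that] .
    have part_eq: "?part x = ?part x'" if X: "X \<in> lcosets K" "x \<in> X" "x' \<in> X" for X x x'
    proof -
      have "?part u \<subseteq> ?part v" if "u \<in> X" "v \<in> X" for u v
      proof -
        obtain k where "k \<in> K" "v = u \<otimes> k"
          using l_coset_eqI[OF Ksub X(1) \<open>u \<in> X\<close>] \<open>v \<in> X\<close> by (auto simp: l_coset_def)
        then show ?thesis
          using commuting_part_mult_right[OF AN K(1,3) y l_coset_eqI(1)[OF Ksub X(1) \<open>u \<in> X\<close>]] by blast
      qed
      then show ?thesis using X by blast
    qed
    \<comment> \<open>As the part is constant on cosets of \<open>K\<close>, \<open>E1\<close> is a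
      finite disjoint union of rectangles, whose measures factor by independence.\<close>
    have "E1 = (\<Union>X\<in>lcosets K. ?part (SOME x. x \<in> X) \<times> X)"
    proof (intro equalityI subsetI)
      fix z assume "z \<in> E1"
      then obtain w x where z: "z = (w, x)" "w \<in> ?part x" "x \<in> carrier G" by (auto simp: E1_def)
      then have X: "x <# K \<in> lcosets K" "x \<in> x <# K"
        using lcos_self[OF _ Ksub] by (auto simp: lcosets_eq_image)
      then show "z \<in> (\<Union>X\<in>lcosets K. ?part (SOME x. x \<in> X) \<times> X)"
        using part_eq[OF X(1,2) some[OF X(1)]] z by blast
    next
      fix z assume "z \<in> (\<Union>X\<in>lcosets K. ?part (SOME x. x \<in> X) \<times> X)"
      then obtain X w x where z: "z = (w, x)" "X \<in> lcosets K" "w \<in> ?part (SOME x. x \<in> X)" "x \<in> X" by blast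
      then show "z \<in> E1" using part_eq[OF z(2,4) some[OF z(2)]] l_coset_eqI(1)[OF Ksub z(2,4)]
        by (simp add: E1_def)
    qed
    moreover have "disjoint_family_on (\<lambda>X. ?part (SOME x. x \<in> X) \<times> X) (lcosets K)"
      using disjoint_lcosets[OF Ksub] by (force simp: disjoint_family_on_def)
    moreover have Xsub: "X \<subseteq> carrier G" if "X \<in> lcosets K" for X
      using l_coset_eqI(1)[OF Ksub that] by blast
    then have "(\<lambda>X. ?part (SOME x. x \<in> X) \<times> X) ` (lcosets K) \<subseteq> sets ?P"
      by (auto simp: sets commuting_part_def)
    ultimately have "measure ?P E1 = (\<Sum>X\<in>lcosets K. measure ?P (?part (SOME x. x \<in> X) \<times> X))"
      using P.finite_measure_finite_Union[OF K(2)] by simp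
    also have "\<dots> = (\<Sum>X\<in>lcosets K. measure \<nu> (?part (SOME x. x \<in> X)) * measure \<mu> X)"
    proof (rule sum.cong[OF refl])
      fix X assume "X \<in> lcosets K"
      then have "emeasure ?P (?part (SOME x. x \<in> X) \<times> X) = emeasure \<nu> (?part (SOME x. x \<in> X)) * emeasure \<mu> X"
        using Xsub by (intro B.emeasure_pair_measure_Times) (auto simp: sets\<nu> sets\<mu> commuting_part_def)
      then show "measure ?P (?part (SOME x. x \<in> X) \<times> X) = measure \<nu> (?part (SOME x. x \<in> X)) * measure \<mu> X"
        by (simp add: measure_def enn2real_mult)
    qed
    finally show ?thesis .
  qed
  finally have eq: "measure (distr ?P \<mu> (\<lambda>(w, x). commutator G w x)) (y <# A) =
    (\<Sum>X\<in>lcosets K. measure \<nu> (?part (SOME x. x \<in> X)) * measure \<mu> X) + measure ?P (E - E1)" .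
  \<comment> \<open>The error is integrated over \<open>w\<close>; the bound on each fibre is
    uniform in \<open>w\<close>.\<close>
  have "emeasure ?P (E - E1) = (\<integral>\<^sup>+w. emeasure \<mu> (Pair w -` (E - E1)) \<partial>\<nu>)"
    using E by (intro B.emeasure_pair_measure_alt) blast
  also have "\<dots> \<le> (\<integral>\<^sup>+w. ennreal (card (lcosets N) * \<delta>) \<partial>\<nu>)"
  proof (rule nn_integral_mono)
    fix w assume "w \<in> space \<nu>"
    then have w: "w \<in> carrier G" by (simp add: sets\<nu>)
    then have "Pair w -` (E - E1) = {x \<in> carrier G. commutator G w x \<in> y <# A \<and> w \<notin> ?part x}"
      by (auto simp: E_def E1_def)
    then show "emeasure \<mu> (Pair w -` (E - E1)) \<le> ennreal (card (lcosets N) * \<delta>)"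
      using measure_noncommuting_le[OF \<mu> AN K(3) y w \<delta>]
      by (simp add: B.emeasure_eq_measure ennreal_leI)
  qed
  also have "\<dots> = ennreal (card (lcosets N) * \<delta>)" by (simp add: A.emeasure_space_1)
  finally have "measure ?P (E - E1) \<le> card (lcosets N) * \<delta>"
    using \<delta>(1) by (simp add: P.emeasure_eq_measure)
  moreover have "measure ?P (E - E1) \<ge> 0" by simp
  ultimately show ?thesis using eq by simp
qed

section \<open>Convergence by induction on the number of entries\<close>

lemma inverse_index_le:
  assumes "subgroup H G" "\<not> index_at_most r H"
  shows "inverse_index G H \<le> 1 / Suc r"
proof (cases "finite (lcosets H)")
  case True
  then have "Suc r \<le> card (lcosets H)" using assms by (simp add: index_at_most_def)
  then have "1 / real (card (lcosets H)) \<le> 1 / Suc r" by (intro divide_left_mono) simp_all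
  then show ?thesis using True by (simp add: inverse_index_def)
qed (simp add: inverse_index_def)

text \<open>\<open>A\<close>, \<open>N\<close> and \<open>y\<close> vary in the induction, because
  the step for \<open>A\<close> uses the hypothesis for the stabilizers, with a witness
  \<open>K\<close> that depends on the desired precision.\<close>

lemma commutator_law_l_coset_convergent:
  assumes fg: "finitely_generated_group G" and AN: "almost_normal A N" and y: "y \<in> carrier G"
  shows "\<exists>L. ((\<lambda>\<mu>. measure (commutator_law G \<mu> k) (y <# A)) \<longlongrightarrow> L) (index_filter G)"
  using AN y
proof (induction k arbitrary: A N y)
  case 0
  then show ?case using tendsto_measure_l_coset[of y G A] by (auto simp: almost_normal_def)
next
  case (Suc k)
  have G: "countable (carrier G)" by (rule finitely_generated_countable[OF fg])
  obtain S where S: "finite S" "S \<subseteq> carrier G" "generate G S = carrier G"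
    using fg by (auto simp: finitely_generated_group_def)
  have N: "N \<lhd> G" "finite (lcosets N)" using Suc.prems by (auto simp: almost_normal_def)
  show ?case
  proof (rule ex_tendsto_if_eventually_close)
    fix \<epsilon> :: real assume \<epsilon>: "\<epsilon> > 0"
    define \<delta> where "\<delta> = \<epsilon> / (2 * (card (lcosets N) + 1))"
    have \<delta>: "\<delta> > 0" "card (lcosets N) * \<delta> \<le> \<epsilon> / 2" using \<epsilon> by (auto simp: \<delta>_def field_simps)
    \<comment> \<open>Half of \<open>\<delta>\<close> is for inverse indices beyond
      \<open>r\<close>, the other half for the deviation of \<open>\<mu>\<close> from them.\<close>
    obtain r where r: "1 / Suc r < \<delta> / 2"
      using reals_Archimedean[of "\<delta> / 2"] \<delta> by (auto simp: inverse_eq_divide)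
    \<comment> \<open>\<open>K\<close> depends on \<open>\<epsilon>\<close> but not on
      \<open>\<mu>\<close>, so the sum over its cosets can be taken to the limit term by
      term.\<close>
    obtain K where K: "K \<lhd> G" "finite (lcosets K)" "K \<subseteq> N"
      and Kr: "\<And>H. index_at_most r H \<Longrightarrow> K \<subseteq> H"
      using ex_normal_subset_index_at_most[OF S N] by blast
    have Ksub: "subgroup K G" using K(1) by (rule normal_imp_subgroup)
    let ?part = "\<lambda>X. commuting_part A K y (SOME x. x \<in> X)"
    define s where "s \<mu> = (\<Sum>X\<in>lcosets K. measure (commutator_law G \<mu> k) (?part X) * measure \<mu> X)" for \<mu>
    \<comment> \<open>Within each coset of \<open>K\<close> the part is empty or a coset of an
      almost normal stabilizer, where the induction hypothesis applies.\<close>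
    have part: "\<exists>L. ((\<lambda>\<mu>. measure (commutator_law G \<mu> k) (commuting_part A K y x)) \<longlongrightarrow> L) (index_filter G)"
      if x: "x \<in> carrier G" for x
    proof -
      have "\<exists>L. ((\<lambda>\<mu>. measure (commutator_law G \<mu> k) (commuting_part A K y x \<inter> Y)) \<longlongrightarrow> L) (index_filter G)"
        if Y: "Y \<in> lcosets K" for Y
      proof (cases "commuting_part A K y x \<inter> Y = {}")
        case False
        obtain g where g: "g \<in> carrier G" "Y = g <# K" using Y by (auto simp: lcosets_eq_image)
        obtain w where w: "w \<in> commuting_part A K y x" "w \<in> g <# K" using False g by blast
        have "commuting_part A K y x \<inter> Y = w <# commuting_stabilizer A K y x"
          unfolding g by (rule commuting_part_Int_l_coset[OF Suc.prems(1) K Suc.prems(2) x g(1) w])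
        moreover have "w \<in> carrier G" using w by (simp add: commuting_part_def)
        ultimately show ?thesis
          using Suc.IH[OF almost_normal_commuting_stabilizer[OF Suc.prems(1) K Suc.prems(2) x]] by simp
      qed auto
      then have "\<exists>L. \<forall>Y\<in>lcosets K.
        ((\<lambda>\<mu>. measure (commutator_law G \<mu> k) (commuting_part A K y x \<inter> Y)) \<longlongrightarrow> L Y) (index_filter G)"
        by (intro bchoice ballI)
      then obtain L where "\<And>Y. Y \<in> lcosets K \<Longrightarrow>
        ((\<lambda>\<mu>. measure (commutator_law G \<mu> k) (commuting_part A K y x \<inter> Y)) \<longlongrightarrow> L Y) (index_filter G)"
        by blast
      then have "((\<lambda>\<mu>. \<Sum>Y\<in>lcosets K. measure (commutator_law G \<mu> k) (commuting_part A K y x \<inter> Y)) \<longlongrightarrow>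
        (\<Sum>Y\<in>lcosets K. L Y)) (index_filter G)"
        by (rule tendsto_sum)
      \<comment> \<open>Additivity over cosets needs a probability measure on \<open>G\<close>,
        which \<open>\<mu>\<close> is only eventually along the filter.\<close>
      moreover have "\<forall>\<^sub>F \<mu> in index_filter G.
        (\<Sum>Y\<in>lcosets K. measure (commutator_law G \<mu> k) (commuting_part A K y x \<inter> Y))
          = measure (commutator_law G \<mu> k) (commuting_part A K y x)"
        using eventually_prob_measure_on
      proof eventually_elim
        case (elim \<mu>)
        show ?case
          by (rule measure_eq_sum_lcosets[OF prob_measure_on_commutator_law[OF G elim] Ksub K(2), symmetric])
            (auto simp: commuting_part_def)
      qed
      ultimately show ?thesis by (intro exI) (rule Lim_transform_eventually)
    qed
    have "\<exists>L. ((\<lambda>\<mu>. measure (commutator_law G \<mu> k) (?part X) * measure \<mu> X) \<longlongrightarrow> L) (index_filter G)"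
      if X: "X \<in> lcosets K" for X
    proof -
      obtain g where g: "g \<in> carrier G" "X = g <# K" using X by (auto simp: lcosets_eq_image)
      have "(SOME x. x \<in> X) \<in> carrier G"
        by (rule l_coset_eqI(1)[OF Ksub X some_mem_lcosets[OF Ksub X]])
      then obtain l where l: "((\<lambda>\<mu>. measure (commutator_law G \<mu> k) (?part X)) \<longlongrightarrow> l) (index_filter G)"
        using part by blast
      have "((\<lambda>\<mu>. measure \<mu> X) \<longlongrightarrow> inverse_index G K) (index_filter G)"
        unfolding g(2) by (rule tendsto_measure_l_coset[OF g(1) Ksub])
      from tendsto_mult[OF l this] show ?thesis by (rule exI)
    qed
    then have "\<exists>L. \<forall>X\<in>lcosets K.
      ((\<lambda>\<mu>. measure (commutator_law G \<mu> k) (?part X) * measure \<mu> X) \<longlongrightarrow> L X) (index_filter G)"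
      by (intro bchoice ballI)
    then obtain L where "\<And>X. X \<in> lcosets K \<Longrightarrow>
      ((\<lambda>\<mu>. measure (commutator_law G \<mu> k) (?part X) * measure \<mu> X) \<longlongrightarrow> L X) (index_filter G)"
      by blast
    then have "(s \<longlongrightarrow> (\<Sum>X\<in>lcosets K. L X)) (index_filter G)"
      unfolding s_def by (rule tendsto_sum)
    then have "\<forall>\<^sub>F \<mu> in index_filter G. dist (s \<mu>) (\<Sum>X\<in>lcosets K. L X) < \<epsilon> / 2"
      using \<epsilon> by (intro tendstoD) simp_all
    moreover have "\<forall>\<^sub>F \<mu> in index_filter G. \<bar>measure (commutator_law G \<mu> (Suc k)) (y <# A) - s \<mu>\<bar> \<le> \<epsilon> / 2"
      using eventually_index_filter[OF half_gt_zero[OF \<delta>(1)], of G]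
    proof eventually_elim
      case (elim \<mu>)
      then have \<mu>: "prob_measure_on G \<mu>" by simp
      \<comment> \<open>By the choice of \<open>K\<close>, a subgroup that does not contain it has
        index more than \<open>r\<close>.\<close>
      have "measure \<mu> (u <# T) \<le> \<delta>" if "u \<in> carrier G" "subgroup T G" "\<not> K \<subseteq> T" for u T
      proof -
        have "\<bar>measure \<mu> (u <# T) - inverse_index G T\<bar> < \<delta> / 2" using elim that by blast
        moreover have "inverse_index G T \<le> 1 / Suc r" using inverse_index_le Kr that by blast
        ultimately show ?thesis using r by linarith
      qed
      from measure_commutator_l_coset_approx[OF G prob_measure_on_commutator_law[OF G \<mu>] \<mu>
          Suc.prems(1) K Suc.prems(2) less_imp_le[OF \<delta>(1)] this]
      have "\<bar>measure (commutator_law G \<mu> (Suc k)) (y <# A) - s \<mu>\<bar> \<le> card (lcosets N) * \<delta>"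
        by (simp add: s_def)
      then show ?case using \<delta>(2) by linarith
    qed
    ultimately have "\<forall>\<^sub>F \<mu> in index_filter G.
      \<bar>measure (commutator_law G \<mu> (Suc k)) (y <# A) - (\<Sum>X\<in>lcosets K. L X)\<bar> \<le> \<epsilon>"
    proof eventually_elim
      case (elim \<mu>)
      then show ?case unfolding dist_real_def by linarith
    qed
    then show "\<exists>l. \<forall>\<^sub>F \<mu> in index_filter G. \<bar>measure (commutator_law G \<mu> (Suc k)) (y <# A) - l\<bar> \<le> \<epsilon>"
      by blast
  qed
qed

text \<open>The instance needed for \<open>dc\<close>: a commutator is trivial iff it lies in the
  coset \<open>\<one> <# {\<one>}\<close>.\<close>

lemma almost_normal_one: "almost_normal {\<one>} (carrier G)"
proof -
  have "lcosets (carrier G) \<subseteq> {carrier G}"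
    by (simp add: lcosets_eq_image image_subset_iff coset_join3 subgroup_self)
  then have "finite (lcosets (carrier G))" by (rule finite_subset) simp
  then show ?thesis
    by (auto simp: almost_normal_def conjugate_one triv_subgroup normal_inv_iff subgroup_self)
qed

end

text \<open>\<open>L\<close> is the limit along \<open>index_filter G\<close>, fixed before
  \<open>M\<close>; composition with any admissible \<open>M\<close> gives the same value.\<close>

lemma dc_convergent:
  assumes "finitely_generated_group G"
  shows "\<exists>L. \<forall>M. measures_index_uniformly G M \<longrightarrow> (\<lambda>n. dc k G (M n)) \<longlonglongrightarrow> L"
proof -
  interpret group G using assms by (simp add: finitely_generated_group_def)
  have G: "countable (carrier G)" by (rule finitely_generated_countable[OF assms])
  have one: "\<one>\<^bsub>G\<^esub> <#\<^bsub>G\<^esub> {\<one>\<^bsub>G\<^esub>} = {\<one>\<^bsub>G\<^esub>}" by (simp add: l_coset_def)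
  obtain L where L: "((\<lambda>\<mu>. measure (commutator_law G \<mu> k) {\<one>\<^bsub>G\<^esub>}) \<longlongrightarrow> L) (index_filter G)"
    using commutator_law_l_coset_convergent[OF assms almost_normal_one one_closed] unfolding one by blast
  have "(\<lambda>n. dc k G (M n)) \<longlonglongrightarrow> L" if M: "measures_index_uniformly G M" for M
  proof -
    have "prob_measure_on G (M n)" for n using M by (simp add: measures_index_uniformly_def)
    then have "dc k G (M n) = measure (commutator_law G (M n) k) {\<one>\<^bsub>G\<^esub>}" for n
      by (rule dc_eq_measure_commutator_law[OF G])
    then show ?thesis using filterlim_compose[OF L filterlim_index_filter[OF M]] by simp
  qed
  then show ?thesis by blast
qed

theorem theorem1p12:
  fixes G :: "('a, 'b) monoid_scheme" and k :: nat
  assumes "finitely_generated_group G"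
  shows "(\<forall>M M'. measures_index_uniformly G M \<longrightarrow> measures_index_uniformly G M' \<longrightarrow>
            dc_limsup k G M = dc_limsup k G M') \<and>
         (\<forall>M. measures_index_uniformly G M \<longrightarrow>
            (\<lambda>n. ereal (dc k G (M n))) \<longlonglongrightarrow> dc_limsup k G M)"
proof -
  obtain L where L: "\<And>M. measures_index_uniformly G M \<Longrightarrow> (\<lambda>n. dc k G (M n)) \<longlonglongrightarrow> L"
    using dc_convergent[OF assms] by blast
  then have lim: "(\<lambda>n. ereal (dc k G (M n))) \<longlonglongrightarrow> ereal L" if "measures_index_uniformly G M" for M
    using that by simp
  have "dc_limsup k G M = ereal L" if "measures_index_uniformly G M" for M
    unfolding dc_limsup_def by (rule lim_imp_Limsup[OF sequentially_bot lim[OF that]])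
  with lim show ?thesis by simp
qed

end
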